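(* Let $s,t \geq 1$ be integers and let $\beta_{s,t}$ be the type-$\beta$ comb with $s$ teeth of length $t$. Then exactly one linear extension of $\beta_{s,t}$ avoids the pattern $132$.
   Context: A linear extension of a finite poset $P$ on a set of integers is a listing $v=[v_1,\dots,v_n]$ of all elements of $P$, each exactly once, such that whenever $a \leq_P b$, $a$ appears before $b$. For $w \in S_3$, a sequence $v$ of distinct integers contains $w$ if there are indices $i<j<k$ with $(v_i,v_j,v_k)$ in the same relative order as $(w_1,w_2,w_3)$; otherwise $v$ avoids $w$. The type-$\beta$ comb $\beta_{s,t}$ is the poset on $\{1,\dots,st\}$ whose order is generated by the relations $ct+1 \leq (c+1)t+1$ for $0 \leq c \leq s-2$ (the spine) and $ct+j \leq ct+j+1$ for $0 \leq c \leq s-1$, $1 \leq j \leq t-1$ (the teeth $\{ct+1,\dots,ct+t\}$). *)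

theory Defs
  imports Main
begin

text \<open>A finite poset is given by its carrier \<open>A\<close> and its order relation \<open>r\<close> (pairs \<open>(a, b)\<close> with
  \<open>a\<close> below or equal to \<open>b\<close>). As \<open>r\<close> is reflexive, the position of \<open>a\<close> is compared with that
  of \<open>b\<close> by \<open>\<le>\<close>; the entries are distinct, so for \<open>a \<noteq> b\<close> this says that \<open>a\<close> appears strictly
  before \<open>b\<close>.\<close>

definition linear_extension :: "'a set \<Rightarrow> 'a rel \<Rightarrow> 'a list \<Rightarrow> bool" where
  "linear_extension A r v \<longleftrightarrow>
     set v = A \<and> distinct v \<and>
     (\<forall>i<length v. \<forall>j<length v. (v ! i, v ! j) \<in> r \<longrightarrow> i \<le> j)"

definition same_relative_order :: "'a::linorder list \<Rightarrow> 'b::linorder list \<Rightarrow> bool" where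
  "same_relative_order xs ys \<longleftrightarrow>
     length xs = length ys \<and>
     (\<forall>i<length xs. \<forall>j<length xs. xs ! i < xs ! j \<longleftrightarrow> ys ! i < ys ! j)"

text \<open>A pattern in \<open>S\<^sub>3\<close> is written in one-line notation, e.g. \<open>[1, 3, 2]\<close> for 132.\<close>

definition contains_pattern :: "'a::linorder list \<Rightarrow> nat list \<Rightarrow> bool" where
  "contains_pattern v w \<longleftrightarrow>
     (\<exists>i j k. i < j \<and> j < k \<and> k < length v \<and> same_relative_order [v ! i, v ! j, v ! k] w)"

abbreviation avoids_pattern :: "'a::linorder list \<Rightarrow> nat list \<Rightarrow> bool" where
  "avoids_pattern v w \<equiv> \<not> contains_pattern v w"

definition comb_carrier :: "nat \<Rightarrow> nat \<Rightarrow> nat set" where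
  "comb_carrier s t = {1..s * t}"

text \<open>The spine condition \<open>c \<le> s - 2\<close> is stated as \<open>c + 2 \<le> s\<close> because subtraction on
  \<open>nat\<close> truncates: for \<open>s = 1\<close> there are no spine relations.\<close>

definition beta_generators :: "nat \<Rightarrow> nat \<Rightarrow> nat rel" where
  "beta_generators s t =
     {(c * t + 1, (c + 1) * t + 1) | c. c + 2 \<le> s} \<union>
     {(c * t + j, c * t + j + 1) | c j. c < s \<and> 1 \<le> j \<and> j + 1 \<le> t}"

text \<open>The intersection only removes the reflexive pairs outside the carrier.\<close>

definition beta_order :: "nat \<Rightarrow> nat \<Rightarrow> nat rel" where
  "beta_order s t = (beta_generators s t)\<^sup>* \<inter> (comb_carrier s t \<times> comb_carrier s t)"

lemma beta_generators_subset:
  assumes "t \<ge> 1"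
  shows "beta_generators s t \<subseteq> comb_carrier s t \<times> comb_carrier s t"
proof -
  have *: "c * t + j \<le> s * t" if "c < s" "j \<le> t" for c j
  proof -
    have "(c + 1) * t \<le> s * t" using that(1) by (intro mult_le_mono1) simp
    with that(2) show ?thesis by simp
  qed
  have "c * t + 1 \<le> s * t \<and> (c + 1) * t + 1 \<le> s * t" if "c + 2 \<le> s" for c
    using *[of c 1] *[of "c + 1" 1] assms that by simp
  moreover have "c * t + j \<le> s * t \<and> c * t + j + 1 \<le> s * t" if "c < s" "j + 1 \<le> t" for c j
    using *[of c j] *[of c "j + 1"] that by simp
  ultimately show ?thesis
    unfolding beta_generators_def comb_carrier_def by fastforce
qed

lemma beta_order_imp_le:
  assumes "(a, b) \<in> beta_order s t"
  shows "a \<le> b"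
proof -
  have "(a, b) \<in> (beta_generators s t)\<^sup>*"
    using assms by (simp add: beta_order_def)
  then show ?thesis
    by (induction rule: rtrancl_induct) (auto simp: beta_generators_def)
qed

lemma partial_order_on_beta_order:
  "partial_order_on (comb_carrier s t) (beta_order s t)"
  unfolding partial_order_on_def preorder_on_def
proof (intro conjI)
  show "antisym (beta_order s t)"
    by (rule antisymI) (meson beta_order_imp_le le_antisym)
  show "trans (beta_order s t)"
    by (rule transI) (auto simp: beta_order_def)
qed (auto simp: beta_order_def refl_on_def)

end

(* The element 1 is the minimum of the comb, so every linear extension begins with 1. A later
   descent would complete an occurrence of 132 with this leading 1, so a 132-avoiding linear
   extension is increasing, i.e. equal to 1, 2, ..., st. *)

theory Submission
  imports Defs
begin

text \<open>The chain \<open>a < c < b\<close> settles all nine comparisons between entries, so the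
  two inequalities capture the whole pattern.\<close>

lemma same_relative_order_132:
  "same_relative_order [a, b, c] [1, 3, 2 :: nat] \<longleftrightarrow> a < c \<and> c < b"
  unfolding same_relative_order_def
  by (auto simp: less_Suc_eq numeral_3_eq_3 numeral_2_eq_2)

lemma contains_132_iff:
  "contains_pattern v [1, 3, 2] \<longleftrightarrow>
     (\<exists>i j k. i < j \<and> j < k \<and> k < length v \<and> v ! i < v ! k \<and> v ! k < v ! j)"
  unfolding contains_pattern_def same_relative_order_132 by blast

lemma sorted_avoids_132:
  assumes "sorted v"
  shows "avoids_pattern v [1, 3, 2]"
  using assms unfolding contains_132_iff
  by (meson leD less_imp_le sorted_nth_mono)

lemma avoids_132_sorted:
  assumes "avoids_pattern v [1, 3, 2]" and "distinct v"
    and min: "\<And>x. x \<in> set v \<Longrightarrow> v ! 0 \<le> x"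
  shows "sorted v"
  unfolding sorted_iff_nth_mono_less
proof (intro allI impI)
  fix j k
  assume "j < k" "k < length v"
  show "v ! j \<le> v ! k"
  proof (cases "j = 0")
    case True
    then show ?thesis using min \<open>k < length v\<close> by simp
  next
    case False
    \<comment> \<open>Distinctness makes the leading entry strictly smaller, as the 1 of an
      occurrence of 132 must be; a descent at \<open>0 < j < k\<close> would supply the 3 and the
      2.\<close>
    have "v ! 0 \<noteq> v ! k"
      using \<open>distinct v\<close> \<open>j < k\<close> \<open>k < length v\<close> nth_eq_iff_index_eq[of v 0 k] by fastforce
    then have "v ! 0 < v ! k"
      using min[of "v ! k"] \<open>k < length v\<close> by simp
    then show ?thesis
      using assms(1) False \<open>j < k\<close> \<open>k < length v\<close> unfolding contains_132_iff
      by (meson not_le_imp_less bot_nat_0.not_eq_extremum)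
  qed
qed

text \<open>Climb the spine from 1 to the base of the tooth containing \<open>a\<close>, then go up
  that tooth.\<close>

lemma beta_order_one_least:
  assumes "a \<in> comb_carrier s t"
  shows "(1, a) \<in> beta_order s t"
proof -
  let ?G = "beta_generators s t"
  have a: "1 \<le> a" "a \<le> s * t"
    using assms by (auto simp: comb_carrier_def)
  then have "t > 0" by (cases t) auto
  have spine: "(1, c * t + 1) \<in> ?G\<^sup>*" if "c < s" for c
    using that
  proof (induction c)
    case (Suc c)
    then have "(c * t + 1, Suc c * t + 1) \<in> ?G"
      by (auto simp: beta_generators_def)
    with Suc show ?case by (meson Suc_lessD rtrancl.rtrancl_into_rtrancl)
  qed simp
  have tooth: "(c * t + 1, c * t + j + 1) \<in> ?G\<^sup>*" if "c < s" "j < t" for c j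
    using that(2)
  proof (induction j)
    case (Suc j)
    \<comment> \<open>Here \<open>j\<close> is a height counted from 0, while the tooth generators
      are indexed from 1; hence \<open>Suc j\<close>.\<close>
    have "(c * t + Suc j, c * t + Suc j + 1) \<in> ?G"
      using that(1) Suc.prems unfolding beta_generators_def by fastforce
    with Suc show ?case by (auto intro: rtrancl.rtrancl_into_rtrancl)
  qed simp
  \<comment> \<open>Elements are numbered from 1, so dividing \<open>a - 1\<close> by
    \<open>t\<close> yields the tooth of \<open>a\<close> and its height above the base.\<close>
  define c where "c = (a - 1) div t"
  define j where "j = (a - 1) mod t"
  have "c < s"
    using a unfolding c_def by (intro less_mult_imp_div_less) auto
  moreover have "j < t"
    using \<open>t > 0\<close> by (simp add: j_def)
  moreover have "a = c * t + j + 1"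
    using a by (simp add: c_def j_def)
  ultimately have "(1, a) \<in> ?G\<^sup>*"
    using spine[of c] tooth[of c j] by (metis rtrancl_trans)
  moreover have "1 \<in> comb_carrier s t"
    unfolding comb_carrier_def atLeastAtMost_iff using a le_trans by blast
  ultimately show ?thesis
    using assms by (simp add: beta_order_def)
qed

lemma linear_extension_beta_hd:
  assumes "linear_extension (comb_carrier s t) (beta_order s t) v" and "v \<noteq> []"
  shows "v ! 0 = 1"
proof -
  have v: "set v = comb_carrier s t"
    using assms(1) by (simp add: linear_extension_def)
  have mem: "v ! 0 \<in> comb_carrier s t"
    using assms(2) v nth_mem[of 0 v] by auto
  \<comment> \<open>The carrier is an interval starting at 1, so it contains 1 as soon as it has any
    element.\<close>
  then have "1 \<in> set v"
    unfolding v comb_carrier_def atLeastAtMost_iff using le_trans by blast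
  then obtain i where "i < length v" "v ! i = 1"
    by (auto simp: in_set_conv_nth)
  \<comment> \<open>As 1 lies below \<open>v ! 0\<close>, its position \<open>i\<close> satisfies
    \<open>i \<le> 0\<close>.\<close>
  with beta_order_one_least[OF mem] assms show ?thesis
    unfolding linear_extension_def by (metis le_zero_eq length_greater_0_conv)
qed

text \<open>The usual order on the naturals extends the comb order, and this list is
  increasing.\<close>

lemma upt_linear_extension_beta:
  "linear_extension (comb_carrier s t) (beta_order s t) [1..<s * t + 1]"
  unfolding linear_extension_def
  by (auto simp: comb_carrier_def simp del: upt_Suc dest!: beta_order_imp_le)

theorem theorem8:
  fixes s t :: nat
  assumes "s \<ge> 1" and "t \<ge> 1"
  shows "\<exists>!v. linear_extension (comb_carrier s t) (beta_order s t) v \<and> avoids_pattern v [1, 3, 2]"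
proof (rule ex1I[of _ "[1..<s * t + 1]"])
  show "linear_extension (comb_carrier s t) (beta_order s t) [1..<s * t + 1] \<and>
      avoids_pattern [1..<s * t + 1] [1, 3, 2]"
    using upt_linear_extension_beta sorted_avoids_132[OF sorted_upt] by blast
next
  fix v
  assume v: "linear_extension (comb_carrier s t) (beta_order s t) v \<and> avoids_pattern v [1, 3, 2]"
  then have set_v: "set v = {1..s * t}" and "distinct v"
    by (auto simp: linear_extension_def comb_carrier_def)
  have "v ! 0 \<le> x" if "x \<in> set v" for x
  proof -
    have "v \<noteq> []" using that by auto
    then have "v ! 0 = 1" using v linear_extension_beta_hd by blast
    then show ?thesis using that set_v by simp
  qed
  then have "sorted v"
    using v \<open>distinct v\<close> avoids_132_sorted by blast
  \<comment> \<open>A sorted list without repetitions is determined by its set of entries.\<close>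
  then show "v = [1..<s * t + 1]"
    using \<open>distinct v\<close> by (rule sorted_distinct_set_unique) (auto simp: set_v simp del: upt_Suc)
qed

end
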